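(* The tetrablock $\mathbb E$ cannot be exhausted by domains biholomorphic to convex domains; that is, there is no sequence of domains $D_1\subset D_2\subset\cdots$ with $\bigcup_j D_j=\mathbb E$ such that each $D_j$ is biholomorphic to a convex domain.
   Context: The tetrablock is $\mathbb E=\{(z_1,z_2,z_3)\in\mathbb C^3:\ |z_2-\bar z_1z_3|+|z_1z_2-z_3|+|z_1|^2<1\}$; equivalently, $\mathbb E$ is the image of $\{x\in\mathcal M(2\times2,\mathbb C):\|x\|<1\}$ ($\|\cdot\|$ the operator norm) under $\pi(x)=(x_{11},x_{22},\det x)$. *)

theory Defs
  imports "HOL-Analysis.Analysis"
begin

definition tetrablock :: "(complex^3) set" where
  "tetrablock = {z. cmod (z$2 - cnj (z$1) * z$3) + cmod (z$1 * z$2 - z$3) + (cmod (z$1))^2 < 1}"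

definition holomorphic_map_on :: "(complex^3) set \<Rightarrow> (complex^3 \<Rightarrow> complex^3) \<Rightarrow> bool" where
  "holomorphic_map_on U f \<longleftrightarrow>
     (\<forall>z\<in>U. \<exists>L. (f has_derivative L) (at z) \<and> (\<forall>c v. L (c *s v) = c *s L v))"

definition cdomain :: "(complex^3) set \<Rightarrow> bool" where
  "cdomain D \<longleftrightarrow> open D \<and> connected D \<and> D \<noteq> {}"

definition biholomorphic :: "(complex^3) set \<Rightarrow> (complex^3) set \<Rightarrow> bool" where
  "biholomorphic D G \<longleftrightarrow> (\<exists>f g. holomorphic_map_on D f \<and> holomorphic_map_on G g \<and>
      f ` D \<subseteq> G \<and> g ` G \<subseteq> D \<and> (\<forall>z\<in>D. g (f z) = z) \<and> (\<forall>w\<in>G. f (g w) = w))"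

end

theory Submission
  imports Defs "HOL-Complex_Analysis.Conformal_Mappings"
begin

text \<open>
  Suppose that \<open>f\<close> maps a large subdomain \<open>D\<close> of the tetrablock biholomorphically onto a convex domain,
  with inverse \<open>g\<close>. For \<open>p = \<plusminus>\<i>\<close> let \<open>\<phi>\<^sub>p(z)\<close> be the \<open>g\<close>-image of the midpoint of \<open>f(z, z, z\<^sup>2)\<close> and
  \<open>f(0, 0, p z\<^sup>2)\<close>. By convexity \<open>\<phi>\<^sub>p\<close> is a holomorphic disc in \<open>D\<close>, and \<open>\<phi>\<^sub>p(z) = (z a\<^sub>p, z b\<^sub>p, z\<^sup>2 c\<^sub>p)\<close> with
  \<open>a\<^sub>p(0) = b\<^sub>p(0) = 1/2\<close>. The value \<open>c\<^sub>p(0)\<close> depends on second derivatives of \<open>f\<close>, but these cancel in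
  the difference \<open>c\<^sub>\<i>(0) - c\<^sub>-\<^sub>\<i>(0) = \<i>\<close>, for which strict differentiability of \<open>f\<close> and \<open>g\<close> suffices.
  Since the tetrablock is invariant under \<open>(z\<^sub>1, z\<^sub>2, z\<^sub>3) \<mapsto> (u z\<^sub>1, u z\<^sub>2, u\<^sup>2 z\<^sub>3)\<close> for \<open>\<bar>u\<bar> = 1\<close>, the maximum
  principle puts both points \<open>(1/2, 1/2, c\<^sub>p(0))\<close>, up to a dilation close to the identity, into its
  closure. No two points whose third coordinates differ by \<open>\<i>\<close> can both be there.
\<close>

section \<open>Holomorphic curves in \<open>complex^'n\<close>\<close>

lemma norm_vector_scalar_mult:
  fixes v :: "complex^'n"
  shows "norm (c *s v) = cmod c * norm v"
  by (simp add: norm_vec_def norm_mult L2_set_right_distrib)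

lemma bounded_linear_vector_scalar_mult_left:
  fixes v :: "complex^'n"
  shows "bounded_linear (\<lambda>c. c *s v)"
  by (rule bounded_linear_intro[where K="norm v"])
     (simp_all add: vec_eq_iff algebra_simps norm_vector_scalar_mult)

text \<open>A derivative of the shape \<open>\<lambda>h. h *s v\<close> expresses complex
  differentiability of a curve with velocity \<open>v\<close>; the chain rule keeps this shape
  because \<open>L\<close> is complex-linear.\<close>

lemma has_derivative_complex_curve:
  assumes "(\<gamma> has_derivative (\<lambda>h. h *s v)) (at z)"
    and "(f has_derivative L) (at (\<gamma> z))" and "\<And>c u. L (c *s u) = c *s L u"
  shows "((\<lambda>t. f (\<gamma> t)) has_derivative (\<lambda>h. h *s L v)) (at z)"
  using has_derivative_compose[OF assms(1,2)] by (simp add: assms(3))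

lemma has_derivative_complex_curve_nth:
  fixes v :: "complex^'n"
  assumes "(\<gamma> has_derivative (\<lambda>h. h *s v)) (at z)"
  shows "((\<lambda>t. \<gamma> t $ k) has_field_derivative v $ k) (at z)"
  using bounded_linear.has_derivative[OF bounded_linear_vec_nth[of k] assms]
  by (simp add: has_field_derivative_def mult.commute[of _ "v $ k"])

lemma has_derivative_quadratic_curve:
  fixes a b :: "complex^'n"
  shows "((\<lambda>z. z *s a + z^2 *s b) has_derivative (\<lambda>h. h *s (a + (2 * z) *s b))) (at z)"
proof -
  have 1: "((\<lambda>z. z *s a) has_derivative (\<lambda>h. h *s a)) (at z)"
    using bounded_linear.has_derivative[OF bounded_linear_vector_scalar_mult_left[of a] has_derivative_ident] .
  have "((\<lambda>z::complex. z^2) has_derivative (\<lambda>h. h * (2 * z))) (at z)"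
    by (rule has_derivative_eq_rhs, rule derivative_intros) (auto simp: fun_eq_iff)
  from bounded_linear.has_derivative[OF bounded_linear_vector_scalar_mult_left[of b] this]
  have 2: "((\<lambda>z. z^2 *s b) has_derivative (\<lambda>h. (h * (2 * z)) *s b)) (at z)" .
  show ?thesis
    by (rule has_derivative_eq_rhs[OF has_derivative_add[OF 1 2]])
       (auto simp: fun_eq_iff vec_eq_iff algebra_simps)
qed

lemma holomorphic_on_component_curve:
  assumes "holomorphic_map_on U f" and "\<And>z. z \<in> S \<Longrightarrow> \<gamma> z \<in> U"
    and "\<And>z. z \<in> S \<Longrightarrow> \<exists>v. (\<gamma> has_derivative (\<lambda>h. h *s v)) (at z)"
  shows "(\<lambda>z. f (\<gamma> z) $ k) holomorphic_on S"
  unfolding holomorphic_on_def field_differentiable_def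
proof
  fix z assume z: "z \<in> S"
  then obtain v L where v: "(\<gamma> has_derivative (\<lambda>h. h *s v)) (at z)"
    and L: "(f has_derivative L) (at (\<gamma> z))" "\<And>c u. L (c *s u) = c *s L u"
    using assms unfolding holomorphic_map_on_def by metis
  from has_derivative_complex_curve_nth[OF has_derivative_complex_curve[OF v L]]
  show "\<exists>f'. ((\<lambda>z. f (\<gamma> z) $ k) has_field_derivative f') (at z within S)"
    using has_field_derivative_at_within by blast
qed

section \<open>Strict differentiability of holomorphic maps\<close>

text \<open>Cauchy's inequality on circles of radius \<open>R/4\<close> about points of the closed
  unit disc bounds the derivative; these circles stay inside the large disc because
  \<open>R \<ge> 2\<close>.\<close>

lemma norm_diff_le_of_bounded_holomorphic:
  fixes e :: "complex \<Rightarrow> complex"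
  assumes hol: "e holomorphic_on ball 0 R" and R: "R \<ge> 2"
    and bd: "\<And>z. z \<in> ball 0 R \<Longrightarrow> cmod (e z) \<le> B"
  shows "cmod (e 1 - e 0) \<le> 4 * B / R"
proof -
  have der: "(e has_field_derivative deriv e z) (at z within cball 0 1)" if "z \<in> cball 0 1" for z
    using that R holomorphic_derivI[OF hol, of z] by auto
  have "cmod (deriv e z) \<le> 4 * B / R" if z: "z \<in> cball 0 1" for z
  proof -
    have sub: "cball z (R/4) \<subseteq> ball 0 R"
      using z R by (auto simp: cball_subset_ball_iff)
    have "cmod ((deriv ^^ 1) e z) \<le> fact 1 * B / (R/4)^1"
    proof (rule Cauchy_inequality)
      show "e holomorphic_on ball z (R/4)" "continuous_on (cball z (R/4)) e"
        using sub hol holomorphic_on_imp_continuous_on holomorphic_on_subset continuous_on_subset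
          ball_subset_cball by (meson order_trans)+
      show "cmod (e x) \<le> B" if "cmod (z - x) = R/4" for x
        using that sub bd[of x] by (auto simp: dist_norm subset_iff)
    qed (use R in auto)
    then show ?thesis by (simp add: mult.commute)
  qed
  from field_differentiable_bound[OF convex_cball der this, of 1 0]
  show ?thesis by simp
qed

text \<open>The definition of \<open>holomorphic_map_on\<close> gives differentiability pointwise,
  without continuity of the derivative. Cauchy's estimate on complex lines turns the smallness of
  the remainder near \<open>x0\<close> into a small Lipschitz constant.\<close>

lemma holomorphic_map_strict_derivative:
  assumes hol: "holomorphic_map_on U f" and U: "open U" "x0 \<in> U"
    and L: "(f has_derivative L) (at x0)" "\<And>c u. L (c *s u) = c *s L u" and eps: "\<epsilon> > 0"
  obtains \<delta> where "\<delta> > 0"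
    "\<And>u v. u \<in> ball x0 \<delta> \<Longrightarrow> v \<in> ball x0 \<delta> \<Longrightarrow> norm (f u - f v - L (u - v)) \<le> \<epsilon> * norm (u - v)"
proof -
  define E where "E x = f x - f x0 - L (x - x0)" for x
  have bl: "bounded_linear L" using L(1) has_derivative_bounded_linear by blast
  interpret bounded_linear L by (rule bl)
  obtain d1 where d1: "d1 > 0" "ball x0 d1 \<subseteq> U" using U openE by blast
  \<comment> \<open>24 is 4 * 2 * 3: Cauchy's estimate costs a factor 4,
    \<open>1 / R = 2 * n / d\<close> a factor 2, and three coordinates are summed.\<close>
  obtain d2 where d2: "d2 > 0" "\<And>x. norm (x - x0) < d2 \<Longrightarrow> norm (E x) \<le> \<epsilon>/24 * norm (x - x0)"
    using L(1) eps unfolding has_derivative_at_alt E_def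
    by (metis divide_pos_pos zero_less_numeral)
  define d where "d = min d1 d2"
  have d: "d > 0" "ball x0 d \<subseteq> U" 
    "\<And>x. x \<in> ball x0 d \<Longrightarrow> norm (E x) \<le> \<epsilon>/24 * norm (x - x0)"
    using d1 d2 by (auto simp: d_def dist_norm norm_minus_commute)
  have holE: "holomorphic_map_on U E"
    unfolding holomorphic_map_on_def
  proof
    fix z assume "z \<in> U"
    then obtain M where M: "(f has_derivative M) (at z)" "\<And>c v. M (c *s v) = c *s M v"
      using hol unfolding holomorphic_map_on_def by blast
    have "(E has_derivative (\<lambda>h. M h - L h)) (at z)"
      unfolding E_def
      by (rule has_derivative_eq_rhs,
          rule derivative_intros M(1) has_derivative[OF has_derivative_diff] | simp)+
    moreover have "\<forall>c v. M (c *s v) - L (c *s v) = c *s (M v - L v)"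
      by (simp add: M L vec_eq_iff algebra_simps)
    ultimately show "\<exists>K. (E has_derivative K) (at z) \<and> (\<forall>c v. K (c *s v) = c *s K v)" by blast
  qed
  show thesis
  \<comment> \<open>This radius forces \<open>n < d/4\<close>, hence \<open>R \<ge> 2\<close>, and
    keeps the disc through \<open>u\<close> and \<open>v\<close> within distance d/8 + d/2 < d of
    \<open>x0\<close>.\<close>
  proof (rule that[of "d/8"])
    show "d/8 > 0" using d by simp
    fix u v assume uv: "u \<in> ball x0 (d/8)" "v \<in> ball x0 (d/8)"
    show "norm (f u - f v - L (u - v)) \<le> \<epsilon> * norm (u - v)"
    proof (cases "u = v")
      case True then show ?thesis by (simp add: zero)
    next
      case False
      define n where "n = norm (u - v)"
      have n: "n > 0" "n < d/4"
        using False norm_triangle_ineq4[of "u - x0" "v - x0"] uv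
        by (auto simp: n_def dist_norm norm_minus_commute)
      \<comment> \<open>\<open>E\<close> is at most \<open>\<epsilon> d / 24\<close> on a disc of radius \<open>R\<close> in the complex line through \<open>u\<close> and \<open>v\<close>;
        Cauchy's estimate gains the factor \<open>1 / R\<close>.\<close>
      define R where "R = d / (2 * n)"
      have R: "R \<ge> 2" using n d by (simp add: R_def field_simps)
      define \<gamma> where "\<gamma> t = v + t *s (u - v)" for t :: complex
      have \<gamma>: "\<gamma> t \<in> ball x0 d" if "t \<in> ball 0 R" for t
      proof -
        have "cmod t * n < R * n" using that n by simp
        then have "cmod t * n < d/2" using n by (simp add: R_def)
        moreover have "norm (\<gamma> t - x0) \<le> norm (v - x0) + cmod t * n"
          unfolding \<gamma>_def n_def norm_vector_scalar_mult[symmetric]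
          by (metis add_diff_eq add.commute diff_add_eq norm_triangle_ineq)
        ultimately show ?thesis using uv d(1) by (auto simp: dist_norm norm_minus_commute)
      qed
      have d\<gamma>: "(\<gamma> has_derivative (\<lambda>h. h *s (u - v))) (at t)" for t
        unfolding \<gamma>_def
        by (rule has_derivative_eq_rhs, rule derivative_intros
            bounded_linear.has_derivative[OF bounded_linear_vector_scalar_mult_left] | simp)+
      have comp: "cmod ((E u - E v) $ k) \<le> \<epsilon>/3 * n" for k
      proof -
        have h: "(\<lambda>t. E (\<gamma> t) $ k) holomorphic_on ball 0 R"
          by (rule holomorphic_on_component_curve[OF holE]) (use \<gamma> d d\<gamma> in blast)+
        have "cmod (E (\<gamma> t) $ k) \<le> \<epsilon>/24 * d" if "t \<in> ball 0 R" for t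
        proof -
          have "cmod (E (\<gamma> t) $ k) \<le> norm (E (\<gamma> t))" by (rule Finite_Cartesian_Product.norm_nth_le)
          also have "\<dots> \<le> \<epsilon>/24 * norm (\<gamma> t - x0)" using \<gamma>[OF that] d by blast
          also have "\<dots> \<le> \<epsilon>/24 * d"
            using \<gamma>[OF that] eps by (intro mult_left_mono) (auto simp: dist_norm norm_minus_commute)
          finally show ?thesis .
        qed
        from norm_diff_le_of_bounded_holomorphic[OF h R this]
        have "cmod (E (\<gamma> 1) $ k - E (\<gamma> 0) $ k) \<le> 4 * (\<epsilon>/24 * d) / R" .
        moreover have "4 * (\<epsilon>/24 * d) / R = \<epsilon>/3 * n" using n(1) d(1) by (simp add: R_def)
        moreover have "\<gamma> 1 = u" "\<gamma> 0 = v" by (auto simp: \<gamma>_def vec_eq_iff)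
        ultimately show ?thesis by simp
      qed
      have "norm (E u - E v) \<le> (\<Sum>k\<in>UNIV. cmod ((E u - E v) $ k))"
        unfolding norm_vec_def by (rule L2_set_le_sum) simp
      also have "\<dots> \<le> (\<Sum>k\<in>(UNIV::3 set). \<epsilon>/3 * n)" by (rule sum_mono) (rule comp)
      also have "\<dots> = \<epsilon> * n" by simp
      also have "E u - E v = f u - f v - L (u - v)" by (simp add: E_def diff)
      finally show ?thesis by (simp add: n_def)
    qed
  qed
qed

section \<open>Points and discs in the tetrablock\<close>

text \<open>The difference quotient has a removable singularity at 0. The case \<open>d = 0\<close>
  is allowed, so that a second factor \<open>z\<close> can be split off afterwards.\<close>

lemma holomorphic_factor_simple_zero:
  fixes f :: "complex \<Rightarrow> complex"
  assumes "f holomorphic_on S" "open S" "f 0 = 0" "(f has_field_derivative d) (at 0)"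
  obtains g where "g holomorphic_on S" "\<And>z. f z = z * g z" "g 0 = d"
proof
  show "(\<lambda>z. if z = 0 then deriv f 0 else (f z - f 0) / (z - 0)) holomorphic_on S"
    using assms(1,2) by (rule pole_lemma_open)
qed (use assms DERIV_imp_deriv in auto)

lemma tetrablock_norm_nth_1:
  assumes "z \<in> tetrablock" shows "cmod (z $ 1) < 1"
proof -
  have "0 \<le> cmod (z$2 - cnj (z$1) * z$3)" "0 \<le> cmod (z$1 * z$2 - z$3)" by simp_all
  moreover have "cmod (z$2 - cnj (z$1) * z$3) + cmod (z$1 * z$2 - z$3) + (cmod (z$1))^2 < 1"
    using assms by (simp add: tetrablock_def)
  ultimately have "(cmod (z$1))^2 < 1" by linarith
  then show ?thesis by (simp add: abs_square_less_1)
qed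

text \<open>
  For fixed \<open>z\<close>, the fraction \<open>(z\<^sub>2 - w z\<^sub>3) / (1 - w z\<^sub>1)\<close> maps the closed unit disc into the disc with centre
  \<open>(z\<^sub>2 - cnj z\<^sub>1 z\<^sub>3) / (1 - \<bar>z\<^sub>1\<bar>\<^sup>2)\<close> and radius \<open>\<bar>z\<^sub>1 z\<^sub>2 - z\<^sub>3\<bar> / (1 - \<bar>z\<^sub>1\<bar>\<^sup>2)\<close>.
\<close>

lemma tetrablock_moebius_bound:
  assumes z: "z \<in> tetrablock" and w: "cmod w \<le> 1"
  shows "cmod (w * z$3 - z$2) \<le> cmod (1 - w * z$1)"
proof -
  define x where "x = z$1"
  have x: "cmod x < 1" using tetrablock_norm_nth_1[OF z] by (simp add: x_def)
  have x2: "x * cnj x = of_real ((cmod x)^2)" by (simp add: complex_norm_square del: of_real_power)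
  have pos: "1 - (cmod x)^2 > 0" using x by (simp add: abs_square_less_1)
  \<comment> \<open>Schwarz-Pick identity: the Blaschke factor with zero \<open>cnj x\<close> has
    modulus at most 1 on the closed disc.\<close>
  have sq: "(cmod (1 - w * x))^2 - (cmod (w - cnj x))^2 = (1 - (cmod w)^2) * (1 - (cmod x)^2)"
    by (simp add: cmod_power2) (simp add: algebra_simps power2_eq_square)
  have "1 - (cmod w)^2 \<ge> 0" using w by (simp add: power_le_one)
  then have "(1 - (cmod w)^2) * (1 - (cmod x)^2) \<ge> 0" using pos by simp
  with sq have "(cmod (w - cnj x))^2 \<le> (cmod (1 - w * x))^2" by linarith
  then have mob: "cmod (w - cnj x) \<le> cmod (1 - w * x)"
    by (rule power2_le_imp_le) simp
  \<comment> \<open>Divided by \<open>(1 - \<bar>x\<bar>\<^sup>2) (1 - w x)\<close>, this writes the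
    fraction as the centre plus a number of modulus the radius times the Blaschke factor.\<close>
  have "(z$2 - w * z$3) * of_real (1 - (cmod x)^2)
      = (z$2 - cnj x * z$3) * (1 - w * x) + (x * z$2 - z$3) * (w - cnj x)"
    unfolding of_real_diff x2[symmetric] by (simp add: algebra_simps)
  then have "cmod (z$2 - w * z$3) * (1 - (cmod x)^2)
      = cmod ((z$2 - cnj x * z$3) * (1 - w * x) + (x * z$2 - z$3) * (w - cnj x))"
    using pos by (metis abs_of_pos norm_mult norm_of_real)
  also have "\<dots> \<le> cmod (z$2 - cnj x * z$3) * cmod (1 - w * x) + cmod (x * z$2 - z$3) * cmod (w - cnj x)"
    by (metis norm_triangle_ineq norm_mult)
  also have "\<dots> \<le> (cmod (z$2 - cnj x * z$3) + cmod (x * z$2 - z$3)) * cmod (1 - w * x)"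
    using mob by (simp add: distrib_right mult_left_mono)
  also have "\<dots> \<le> (1 - (cmod x)^2) * cmod (1 - w * x)"
    using z by (intro mult_right_mono) (auto simp: tetrablock_def x_def)
  finally show ?thesis using pos by (simp add: x_def norm_minus_commute mult.commute)
qed

text \<open>These points are the images under \<pi> of the scalar matrices of norm less than
  1.\<close>

lemma diagonal_in_tetrablock:
  assumes "cmod s < 1" shows "vector [s, s, s^2] \<in> tetrablock"
proof -
  define t where "t = cmod s"
  have t: "0 \<le> t" "t < 1" using assms by (auto simp: t_def)
  have "s - cnj s * s^2 = s * of_real (1 - t^2)"
    using complex_norm_square[of s] by (simp add: t_def power2_eq_square algebra_simps)
  then have "cmod (s - cnj s * s^2) = t * (1 - t^2)"
    using t by (simp add: norm_mult abs_square_le_1 t_def[symmetric] del: of_real_diff of_real_power)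
  moreover have "(1 - t^2) * (1 - t) > 0"
    using t by (simp add: abs_square_less_1)
  then have "t * (1 - t^2) + t^2 < 1"
    by (simp add: algebra_simps)
  moreover have "s * s - s^2 = 0" by (simp add: power2_eq_square)
  ultimately show ?thesis
    by (simp add: tetrablock_def t_def)
qed

lemma third_axis_in_tetrablock: "cmod s < 1 \<Longrightarrow> vector [0, 0, s] \<in> tetrablock"
  by (simp add: tetrablock_def)

lemma maximum_modulus_cball:
  assumes "f holomorphic_on ball \<xi> \<rho>" "continuous_on (cball \<xi> \<rho>) f"
    and "\<And>z. z \<in> sphere \<xi> \<rho> \<Longrightarrow> cmod (f z) \<le> B" and "z \<in> cball \<xi> \<rho>"
  shows "cmod (f z) \<le> B"
  by (rule maximum_modulus_frontier[of f "cball \<xi> \<rho>"])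
     (use assms in \<open>simp_all only: interior_cball frontier_cball closure_closed[OF closed_cball] bounded_cball\<close>)

text \<open>For \<open>cmod z = \<rho>\<close> the point with coordinates
  \<open>\<rho> * a z\<close>, \<open>\<rho> * b z\<close>, \<open>\<rho>\<^sup>2 * c z\<close> is a
  rotation of \<open>x z\<close> and so satisfies the Moebius bound. The maximum principle for the
  quotient \<open>q\<close> carries the bound to the centre, where \<open>x\<close> itself
  vanishes.\<close>

lemma tetrablock_disc_centre_bound:
  fixes \<rho> r :: real and a b c :: "complex \<Rightarrow> complex"
  assumes hol: "a holomorphic_on ball 0 r" "b holomorphic_on ball 0 r" "c holomorphic_on ball 0 r"
    and \<rho>: "0 < \<rho>" "\<rho> < r"
    and E: "\<And>z. z \<in> ball 0 r \<Longrightarrow> x z \<in> tetrablock"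
    and x: "\<And>z. x z $ 1 = z * a z" "\<And>z. x z $ 2 = z * b z" "\<And>z. x z $ 3 = z * (z * c z)"
    and w: "cmod w \<le> 1"
  shows "cmod (w * (\<rho>\<^sup>2 * c 0) - \<rho> * b 0) \<le> cmod (1 - w * (\<rho> * a 0))"
proof -
  have sub: "cball 0 \<rho> \<subseteq> ball (0::complex) r" using \<rho> by auto
  have cont: "continuous_on (cball 0 \<rho>) a" "continuous_on (cball 0 \<rho>) b" "continuous_on (cball 0 \<rho>) c"
    using hol sub holomorphic_on_imp_continuous_on holomorphic_on_subset by blast+
  have hol': "a holomorphic_on ball 0 \<rho>" "b holomorphic_on ball 0 \<rho>" "c holomorphic_on ball 0 \<rho>"
    using hol sub ball_subset_cball holomorphic_on_subset by blast+
  \<comment> \<open>Since the maximum on the circle is attained, the bound by 1 stays strict, and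
    the denominator of \<open>q\<close> has no zero even for \<open>cmod w = 1\<close>.\<close>
  have "continuous_on (sphere 0 \<rho>) (\<lambda>z. cmod (\<rho> * a z))"
    by (intro continuous_intros continuous_on_subset[OF cont(1)]) auto
  then obtain z0 where z0: "z0 \<in> sphere 0 \<rho>"
    "\<And>z. z \<in> sphere 0 \<rho> \<Longrightarrow> cmod (\<rho> * a z) \<le> cmod (\<rho> * a z0)"
    using continuous_attains_sup[of "sphere (0::complex) \<rho>" "\<lambda>z. cmod (\<rho> * a z)"] \<rho> by auto
  have "cmod (x z0 $ 1) < 1" using z0 \<rho> by (intro tetrablock_norm_nth_1 E) auto
  then have B: "cmod (\<rho> * a z0) < 1" using z0 \<rho> by (simp add: x norm_mult)
  have a1: "cmod (\<rho> * a z) < 1" if "z \<in> cball 0 \<rho>" for z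
  proof -
    have "cmod (\<rho> * a z) \<le> cmod (\<rho> * a z0)"
      by (rule maximum_modulus_cball[of "\<lambda>z. \<rho> * a z" 0 \<rho>, OF _ _ z0(2) that])
        (intro holomorphic_intros hol' continuous_intros cont | assumption)+
    with B show ?thesis by simp
  qed
  have nz: "1 - w * (\<rho> * a z) \<noteq> 0" if "z \<in> cball 0 \<rho>" for z
  proof
    assume "1 - w * (\<rho> * a z) = 0"
    then have "w * (\<rho> * a z) = 1" by (metis eq_iff_diff_eq_0)
    then have "cmod (w * (\<rho> * a z)) = 1" by (metis norm_one)
    moreover have "cmod (w * (\<rho> * a z)) \<le> cmod (\<rho> * a z)"
      using w by (simp add: norm_mult mult_left_le_one_le)
    ultimately show False using a1[OF that] by simp
  qed
  define q :: "complex \<Rightarrow> complex" where "q z = (w * (\<rho>\<^sup>2 * c z) - \<rho> * b z) / (1 - w * (\<rho> * a z))" for z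
  have "cmod (q 0) \<le> 1"
  proof (rule maximum_modulus_cball[of q 0 \<rho>])
    show "q holomorphic_on ball 0 \<rho>" "continuous_on (cball 0 \<rho>) q"
      unfolding q_def
      by (intro holomorphic_intros hol' continuous_intros cont ballI nz; simp)+
    fix z :: complex assume "z \<in> sphere 0 \<rho>"
    then have z: "cmod z = \<rho>" by simp
    then have z0: "z \<noteq> 0" and zr: "z \<in> ball 0 r" using \<rho> by auto
    \<comment> \<open>Rotating \<open>w\<close> replaces the invariance of the tetrablock under \<open>(z\<^sub>1, z\<^sub>2, z\<^sub>3) \<mapsto> (u z\<^sub>1, u z\<^sub>2, u\<^sup>2 z\<^sub>3)\<close>, \<open>\<bar>u\<bar> = 1\<close>.\<close>
    have "cmod (w * \<rho> / z) \<le> 1" using w z \<rho> by (simp add: norm_mult norm_divide)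
    from tetrablock_moebius_bound[OF E[OF zr] this]
    have "cmod (z * (w * \<rho> * c z - b z)) \<le> cmod (1 - w * (\<rho> * a z))"
      using z0 by (simp add: x algebra_simps)
    moreover have "cmod (w * (\<rho>\<^sup>2 * c z) - \<rho> * b z) = cmod (of_real \<rho> * (w * \<rho> * c z - b z))"
      by (simp add: algebra_simps power2_eq_square)
    ultimately show "cmod (q z) \<le> 1"
      using z \<rho> nz[of z] by (simp add: q_def norm_mult norm_divide)
  qed (use \<rho>(1) in simp_all)
  then show ?thesis using nz[of 0] \<rho> by (simp add: q_def norm_divide field_simps)
qed

section \<open>Compact sets in the exhaustion and the final inequality\<close>

lemma incseq_open_cover_compact:
  assumes "\<And>j. open (D j)" "\<And>j. D j \<subseteq> D (Suc j)" "compact K" "K \<subseteq> (\<Union>j::nat. D j)"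
  obtains j where "K \<subseteq> D j"
proof -
  have mono: "D i \<subseteq> D j" if "i \<le> j" for i j
    using lift_Suc_mono_le[of D, OF assms(2) that] .
  obtain J where J: "finite J" "K \<subseteq> (\<Union>j\<in>J. D j)"
    using compactE_image[OF assms(3), of UNIV D] assms(1,4) by auto
  \<comment> \<open>Inserting 0 keeps the maximum meaningful when \<open>J\<close> is empty.\<close>
  have "K \<subseteq> D (Max (insert 0 J))"
  proof
    fix y assume "y \<in> K"
    then obtain j where "j \<in> J" "y \<in> D j" using J by blast
    moreover have "j \<le> Max (insert 0 J)" using J \<open>j \<in> J\<close> by simp
    ultimately show "y \<in> D (Max (insert 0 J))" using mono by blast
  qed
  then show thesis by (rule that)
qed

text \<open>The constants are \<open>\<rho>\<^sup>2 = 361/400\<close> and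
  \<open>\<rho>/2 = 19/40\<close> for \<open>\<rho> = 19/20\<close>: the bounds at the centre of a
  disc with \<open>a 0 = b 0 = 1/2\<close>.\<close>

lemma moebius_bounds_incompatible:
  fixes c d :: complex
  assumes diff: "c - d = \<i>"
    and bd: "\<And>w. cmod w \<le> 1 \<Longrightarrow> cmod (w * (361/400 * c) - 19/40) \<le> cmod (1 - w * (19/40))"
      "\<And>w. cmod w \<le> 1 \<Longrightarrow> cmod (w * (361/400 * d) - 19/40) \<le> cmod (1 - w * (19/40))"
  shows False
proof -
  define x y where "x = Re d" and "y = Im d"
  have d: "Re d = x" "Im d = y" and c: "Re c = x" "Im c = y + 1"
    using arg_cong[OF diff, of Re] arg_cong[OF diff, of Im] by (auto simp: x_def y_def)
  \<comment> \<open>The average of \<open>c\<close> and \<open>d\<close> is arbitrary. The bound for \<open>c\<close> is sharpest for \<open>w\<close> in the direction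
    opposite to \<open>cnj (\<rho>\<^sup>2 c - 1)\<close>, where \<open>\<rho> = 19/20\<close>; for the least favourable average this is roughly \<open>u\<close>,
    and \<open>v\<close> for \<open>d\<close>.\<close>
  define u v where "u = Complex (4/5) (3/5)" and "v = Complex (4/5) (-3/5)"
  have uv: "Re u = 4/5" "Im u = 3/5" "Re v = 4/5" "Im v = -3/5" by (auto simp: u_def v_def)
  have "cmod u \<le> 1" "cmod v \<le> 1"
    by (simp_all add: cmod_def power2_eq_square uv)
  then have sq: "(cmod (u * (361/400 * c) - 19/40))\<^sup>2 \<le> (cmod (1 - u * (19/40)))\<^sup>2"
    "(cmod (v * (361/400 * d) - 19/40))\<^sup>2 \<le> (cmod (1 - v * (19/40)))\<^sup>2"
    using bd by (auto intro!: power_mono)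
  have parts: "Re (u * (361/400 * c) - 19/40) = 4/5*(361/400*x) - 3/5*(361/400*(y+1)) - 19/40"
    "Im (u * (361/400 * c) - 19/40) = 4/5*(361/400*(y+1)) + 3/5*(361/400*x)"
    "Re (v * (361/400 * d) - 19/40) = 4/5*(361/400*x) + 3/5*(361/400*y) - 19/40"
    "Im (v * (361/400 * d) - 19/40) = 4/5*(361/400*y) - 3/5*(361/400*x)"
    "Re (1 - u * (19/40)) = 31/50" "Im (1 - u * (19/40)) = - 57/200"
    "Re (1 - v * (19/40)) = 31/50" "Im (1 - v * (19/40)) = 57/200"
    by (simp_all add: c d uv)
  define X Y where "X = 361/400*x" and "Y = 361/400*y"
  have XY: "361/400*x = X" "361/400*(y+1) = Y + 361/400" "361/400*y = Y"
    by (simp_all add: X_def Y_def algebra_simps)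
  note ineq = sq[unfolded cmod_power2 parts XY]
  \<comment> \<open>Adding the two inequalities and completing squares removes the unknown
    \<open>d\<close>: the constant left over, 346921/320000, exceeds the sum 149/160 of the
    right-hand sides.\<close>
  have "(4/5*X - 3/5*(Y + 361/400) - 19/40)\<^sup>2 + (4/5*(Y + 361/400) + 3/5*X)\<^sup>2
      + ((4/5*X + 3/5*Y - 19/40)\<^sup>2 + (4/5*Y - 3/5*X)\<^sup>2)
      = 2*(X - 19/50)\<^sup>2 + 2*(Y + 361/800)\<^sup>2 + (361/400)\<^sup>2/2 + 2*(19/40)\<^sup>2
        + 57/100*(361/400) - 2*(19/50)\<^sup>2"
    by (simp add: power2_eq_square field_simps)
  moreover have "(X - 19/50)\<^sup>2 \<ge> 0" "(Y + 361/800)\<^sup>2 \<ge> 0" by simp_all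
  moreover have "(31/50)\<^sup>2 + (- 57/200)\<^sup>2 = (149/320::real)" "(31/50)\<^sup>2 + (57/200)\<^sup>2 = (149/320::real)"
    "(361/400)\<^sup>2/2 + 2*(19/40)\<^sup>2 + 57/100*(361/400) - 2*(19/50)\<^sup>2 = (346921/320000::real)"
    by (simp_all add: power2_eq_square)
  ultimately show False using ineq by linarith
qed

section \<open>Pulling back midpoints\<close>

lemma holomorphic_inverse_derivative:
  assumes "open D" "x0 \<in> D" "\<And>z. z \<in> D \<Longrightarrow> g (f z) = z"
    and "(f has_derivative A) (at x0)" "(g has_derivative B) (at (f x0))"
  shows "B (A u) = u"
proof -
  have "((\<lambda>x. g (f x)) has_derivative (\<lambda>u. B (A u))) (at x0)"
    using has_derivative_compose[OF assms(4,5)] .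
  moreover have "((\<lambda>x. g (f x)) has_derivative (\<lambda>u. u)) (at x0)"
    by (rule has_derivative_transform_within_open[OF has_derivative_ident assms(1,2)])
       (simp add: assms(3))
  ultimately show ?thesis using has_derivative_unique by metis
qed

text \<open>To first order \<open>g\<close> undoes \<open>f\<close>, and the common endpoint
  \<open>f (a z)\<close> cancels. Strict differentiability makes the error small relative to
  \<open>u z - v z\<close>, even when \<open>a z\<close> tends to \<open>x0\<close> much more slowly
  than this difference tends to 0.\<close>

lemma midpoint_pullback_difference:
  assumes f: "holomorphic_map_on D f" and D: "open D" "x0 \<in> D"
    and g: "holomorphic_map_on G g" and G: "open G" "f x0 \<in> G"
    and inv: "\<And>z. z \<in> D \<Longrightarrow> g (f z) = z"
    and lim: "(a \<longlongrightarrow> x0) F" "(u \<longlongrightarrow> x0) F" "(v \<longlongrightarrow> x0) F"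
    and \<epsilon>: "\<epsilon> > 0"
  shows "\<forall>\<^sub>F z in F. norm (g (midpoint (f (a z)) (f (u z))) - g (midpoint (f (a z)) (f (v z)))
            - (1/2) *\<^sub>R (u z - v z)) \<le> \<epsilon> * norm (u z - v z)"
proof -
  obtain A where A: "(f has_derivative A) (at x0)" "\<And>c v. A (c *s v) = c *s A v"
    using f D unfolding holomorphic_map_on_def by blast
  obtain B where B: "(g has_derivative B) (at (f x0))" "\<And>c v. B (c *s v) = c *s B v"
    using g G unfolding holomorphic_map_on_def by blast
  have BA: "B (A x) = x" for x
    by (rule holomorphic_inverse_derivative[OF D inv A(1) B(1)])
  interpret A: bounded_linear A using A(1) by (rule has_derivative_bounded_linear)
  interpret B: bounded_linear B using B(1) by (rule has_derivative_bounded_linear)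
  obtain KA where KA: "KA > 0" "\<And>x. norm (A x) \<le> norm x * KA" using A.pos_bounded by blast
  obtain KB where KB: "KB > 0" "\<And>x. norm (B x) \<le> norm x * KB" using B.pos_bounded by blast
  \<comment> \<open>The error of \<open>g\<close> contributes \<open>\<eta> * (KA + 1)\<close> and
    that of \<open>f\<close> contributes \<open>\<eta> * KB\<close>; the cap 1 bounds
    \<open>e\<close> by \<open>n\<close>.\<close>
  define \<eta> where "\<eta> = min 1 (\<epsilon> / (KA + 1 + KB))"
  have "\<eta> \<le> \<epsilon> / (KA + 1 + KB)" by (simp add: \<eta>_def)
  then have \<eta>: "\<eta> > 0" "\<eta> \<le> 1" "\<eta> * (KA + 1 + KB) \<le> \<epsilon>"
    using \<epsilon> KA(1) KB(1) by (simp_all add: \<eta>_def[symmetric] pos_le_divide_eq) (simp_all add: \<eta>_def)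
  obtain d1 where d1: "d1 > 0" "\<And>x y. x \<in> ball x0 d1 \<Longrightarrow> y \<in> ball x0 d1 \<Longrightarrow>
      norm (f x - f y - A (x - y)) \<le> \<eta> * norm (x - y)"
    using holomorphic_map_strict_derivative[OF f D A \<eta>(1)] by blast
  obtain d2 where d2: "d2 > 0" "\<And>x y. x \<in> ball (f x0) d2 \<Longrightarrow> y \<in> ball (f x0) d2 \<Longrightarrow>
      norm (g x - g y - B (x - y)) \<le> \<eta> * norm (x - y)"
    using holomorphic_map_strict_derivative[OF g G B \<eta>(1)] by blast
  have fc: "isCont f x0" using A(1) by (rule has_derivative_continuous)
  have lf: "((\<lambda>z. f (a z)) \<longlongrightarrow> f x0) F" "((\<lambda>z. f (u z)) \<longlongrightarrow> f x0) F" "((\<lambda>z. f (v z)) \<longlongrightarrow> f x0) F"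
    using isCont_tendsto_compose[OF fc] lim by auto
  have lm: "((\<lambda>z. midpoint (f (a z)) (f (u z))) \<longlongrightarrow> midpoint (f x0) (f x0)) F"
      "((\<lambda>z. midpoint (f (a z)) (f (v z))) \<longlongrightarrow> midpoint (f x0) (f x0)) F"
    unfolding midpoint_def by (intro tendsto_intros lf)+
  have "\<forall>\<^sub>F z in F. midpoint (f (a z)) (f (u z)) \<in> ball (f x0) d2"
       "\<forall>\<^sub>F z in F. midpoint (f (a z)) (f (v z)) \<in> ball (f x0) d2"
    using topological_tendstoD[OF lm(1), of "ball (f x0) d2"]
      topological_tendstoD[OF lm(2), of "ball (f x0) d2"] d2(1) by auto
  moreover have "\<forall>\<^sub>F z in F. u z \<in> ball x0 d1" "\<forall>\<^sub>F z in F. v z \<in> ball x0 d1"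
    using topological_tendstoD[OF lim(2), of "ball x0 d1"]
      topological_tendstoD[OF lim(3), of "ball x0 d1"] d1(1) by auto
  ultimately show ?thesis
  proof eventually_elim
    case (elim z)
    define mu mv where "mu = midpoint (f (a z)) (f (u z))" and "mv = midpoint (f (a z)) (f (v z))"
    define n where "n = norm (u z - v z)"
    define e where "e = f (u z) - f (v z) - A (u z - v z)"
    have e: "norm e \<le> \<eta> * n" using d1(2)[of "u z" "v z"] elim by (simp add: e_def n_def)
    have m: "mu - mv = (1/2) *\<^sub>R (A (u z - v z) + e)"
      by (simp add: mu_def mv_def midpoint_def e_def algebra_simps)
    have "norm (A (u z - v z) + e) \<le> n * KA + n * 1"
    proof (rule norm_triangle_mono)
      show "norm (A (u z - v z)) \<le> n * KA" using KA(2) by (simp add: n_def)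
      have "\<eta> * n \<le> n * 1" using \<eta> by (simp add: n_def mult_left_le_one_le)
      with e show "norm e \<le> n * 1" by linarith
    qed
    then have nm: "norm (mu - mv) \<le> n * (KA + 1)"
      using norm_ge_zero[of "A (u z - v z) + e"] unfolding m norm_scaleR distrib_left abs_divide abs_one abs_numeral by linarith
    have "B (mu - mv) = (1/2) *\<^sub>R (u z - v z) + (1/2) *\<^sub>R B e"
      unfolding m by (simp only: B.scaleR B.add BA scaleR_add_right)
    then have X: "(1/2) *\<^sub>R (u z - v z) = B (mu - mv) - (1/2) *\<^sub>R B e" by simp
    have "norm (g mu - g mv - (1/2) *\<^sub>R (u z - v z))
      = norm ((g mu - g mv - B (mu - mv)) + (1/2) *\<^sub>R B e)"
      unfolding X by (simp only: diff_diff_eq2 diff_add_eq)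
    also have "\<dots> \<le> \<eta> * (n * (KA + 1)) + \<eta> * (n * KB)"
    proof (rule norm_triangle_mono)
      have "norm (g mu - g mv - B (mu - mv)) \<le> \<eta> * norm (mu - mv)"
        using d2(2)[of mu mv] elim by (simp add: mu_def mv_def)
      also have "\<dots> \<le> \<eta> * (n * (KA + 1))" using nm \<eta>(1) by simp
      finally show "norm (g mu - g mv - B (mu - mv)) \<le> \<eta> * (n * (KA + 1))" .
      have "norm ((1/2) *\<^sub>R B e) \<le> norm (B e)" by simp
      also have "\<dots> \<le> norm e * KB" by (rule KB)
      also have "\<dots> \<le> \<eta> * n * KB" using e KB(1) by simp
      finally show "norm ((1/2) *\<^sub>R B e) \<le> \<eta> * (n * KB)" by (simp add: mult.assoc)
    qed
    also have "\<dots> = (\<eta> * (KA + 1 + KB)) * n" by (simp add: algebra_simps)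
    also have "\<dots> \<le> \<epsilon> * n" using \<eta>(3) by (intro mult_right_mono) (simp_all add: n_def)
    finally show ?case by (simp add: mu_def mv_def n_def)
  qed
qed

section \<open>Subdomains containing the three discs\<close>

lemma diagonal_curve_conv:
  "vector [z, z, z^2] = z *s vector [1, 1, 0] + z^2 *s (vector [0, 0, 1] :: complex^3)"
  unfolding vec_eq_iff forall_3 by simp

text \<open>The zero linear term gives the curve the shape treated in
  \<open>has_derivative_quadratic_curve\<close>.\<close>

lemma axis_curve_conv:
  "vector [0, 0, p * z^2] = z *s 0 + z^2 *s (p *s vector [0, 0, 1] :: complex^3)"
  unfolding vec_eq_iff forall_3 by simp

lemma tetrablock_subdomain_not_biholomorphic_convex:
  fixes r :: real
  assumes r: "r > 19/20" and D: "open D" "D \<subseteq> tetrablock"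
    and diagonal: "\<And>z. z \<in> ball 0 r \<Longrightarrow> vector [z, z, z^2] \<in> D"
    and axis: "\<And>p z. p \<in> {\<i>, -\<i>} \<Longrightarrow> z \<in> ball 0 r \<Longrightarrow> vector [0, 0, p * z^2] \<in> D"
    and G: "open G" "convex G" and bih: "biholomorphic D G"
  shows False
proof -
  define \<gamma> where "\<gamma> z = z *s vector [1, 1, 0] + z^2 *s (vector [0, 0, 1] :: complex^3)" for z
  define \<kappa> where "\<kappa> p z = z *s 0 + z^2 *s (p *s vector [0, 0, 1] :: complex^3)" for p z
  have curves: "\<And>z. z \<in> ball 0 r \<Longrightarrow> \<gamma> z \<in> D"
      "\<And>p z. p \<in> {\<i>, -\<i>} \<Longrightarrow> z \<in> ball 0 r \<Longrightarrow> \<kappa> p z \<in> D"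
    unfolding \<gamma>_def \<kappa>_def diagonal_curve_conv[symmetric] axis_curve_conv[symmetric]
    by (fact diagonal axis)+
  obtain f g where f: "holomorphic_map_on D f" "f ` D \<subseteq> G"
    and g: "holomorphic_map_on G g" "g ` G \<subseteq> D"
    and inv: "\<And>z. z \<in> D \<Longrightarrow> g (f z) = z"
    using bih unfolding biholomorphic_def by blast
  have 0: "\<gamma> 0 = 0" "\<kappa> p 0 = 0" for p by (simp_all add: \<gamma>_def \<kappa>_def vec_eq_iff)
  have D0: "0 \<in> D" using curves(1)[of 0] r 0 by simp
  have G0: "f 0 \<in> G" using f D0 by blast
  obtain A where A: "(f has_derivative A) (at 0)" "\<And>c v. A (c *s v) = c *s A v"
    using f D0 unfolding holomorphic_map_on_def by blast
  obtain B where B: "(g has_derivative B) (at (f 0))" "\<And>c v. B (c *s v) = c *s B v"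
    using g G0 unfolding holomorphic_map_on_def by blast
  have BA: "B (A x) = x" for x
    by (rule holomorphic_inverse_derivative[OF D(1) D0 inv A(1) B(1)])
  interpret A: bounded_linear A using A(1) by (rule has_derivative_bounded_linear)
  interpret B: bounded_linear B using B(1) by (rule has_derivative_bounded_linear)
  define h where "h p z = midpoint (f (\<gamma> z)) (f (\<kappa> p z))" for p z
  have hG: "h p z \<in> G" if "p \<in> {\<i>, -\<i>}" "z \<in> ball 0 r" for p z
    unfolding h_def using curves that f(2) closed_segment_subset[OF _ _ G(2)] midpoint_in_closed_segment(1)
    by (metis image_subset_iff subset_eq)
  have dmid: "((\<lambda>z. midpoint (F z) (H z)) has_derivative (\<lambda>h. h *s midpoint v w)) (at z)"
    if "(F has_derivative (\<lambda>h. h *s v)) (at z)" "(H has_derivative (\<lambda>h. h *s w)) (at z)"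
    for F H :: "complex \<Rightarrow> complex^3" and v w z
    unfolding midpoint_def
    by (rule has_derivative_eq_rhs[OF has_derivative_scaleR_right[OF has_derivative_add[OF that]]])
       (simp add: vec_eq_iff fun_eq_iff algebra_simps)
  note dcurve = has_derivative_quadratic_curve
  have dh: "\<exists>v. (h p has_derivative (\<lambda>h. h *s v)) (at z)" if p: "p \<in> {\<i>, -\<i>}" and z: "z \<in> ball 0 r" for p z
  proof -
    obtain L M where "(f has_derivative L) (at (\<gamma> z))" "\<And>c v. L (c *s v) = c *s L v"
      "(f has_derivative M) (at (\<kappa> p z))" "\<And>c v. M (c *s v) = c *s M v"
      using f(1) curves p z unfolding holomorphic_map_on_def by metis
    then show ?thesis
      unfolding h_def \<gamma>_def \<kappa>_def
      using dmid[OF has_derivative_complex_curve[OF dcurve] has_derivative_complex_curve[OF dcurve]]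
      by blast
  qed
  \<comment> \<open>The quadratic terms vanish to first order at 0, so this velocity does not depend
    on \<open>p\<close>.\<close>
  have dh0: "(h p has_derivative (\<lambda>h. h *s midpoint (A (vector [1, 1, 0])) (A 0))) (at 0)" for p
  proof -
    have "((\<lambda>z. f (\<gamma> z)) has_derivative (\<lambda>h. h *s A (vector [1, 1, 0] + (2 * 0) *s vector [0, 0, 1]))) (at 0)"
      unfolding \<gamma>_def
      by (rule has_derivative_complex_curve[OF dcurve _ A(2)]) (use A(1) 0 in \<open>simp add: \<gamma>_def\<close>)
    moreover have "((\<lambda>z. f (\<kappa> p z)) has_derivative (\<lambda>h. h *s A (0 + (2 * 0) *s (p *s vector [0, 0, 1])))) (at 0)"
      unfolding \<kappa>_def
      by (rule has_derivative_complex_curve[OF dcurve _ A(2)]) (use A(1) 0 in \<open>simp add: \<kappa>_def\<close>)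
    ultimately show ?thesis unfolding h_def using dmid by fastforce
  qed
  have h0: "h p 0 = f 0" for p by (simp add: h_def 0)
  define \<phi> where "\<phi> p z = g (h p z)" for p z
  have \<phi>T: "\<phi> p z \<in> tetrablock" if "p \<in> {\<i>, -\<i>}" "z \<in> ball 0 r" for p z
    using hG[OF that] g D unfolding \<phi>_def by blast
  have \<phi>hol: "(\<lambda>z. \<phi> p z $ k) holomorphic_on ball 0 r" if "p \<in> {\<i>, -\<i>}" for p k
    unfolding \<phi>_def by (rule holomorphic_on_component_curve[OF g(1)]) (use hG dh that in blast)+
  have \<phi>0: "\<phi> p 0 = 0" for p by (simp add: \<phi>_def h0 inv D0)
  have d\<phi>0: "((\<lambda>z. \<phi> p z $ k) has_field_derivative (vector [1/2, 1/2, 0] :: complex^3) $ k) (at 0)" for p k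
  proof -
    have "B (midpoint (A (vector [1, 1, 0])) (A 0)) = vector [1/2, 1/2, 0]"
      unfolding midpoint_def B.scaleR B.add BA
      by (simp add: vec_eq_iff forall_3) (simp add: scaleR_conv_of_real)
    moreover have "((\<lambda>z. \<phi> p z) has_derivative (\<lambda>h. h *s B (midpoint (A (vector [1, 1, 0])) (A 0)))) (at 0)"
      unfolding \<phi>_def by (rule has_derivative_complex_curve[OF dh0 _ B(2)]) (simp add: h0 B(1))
    ultimately show ?thesis using has_derivative_complex_curve_nth by metis
  qed
  have ex: "\<exists>a b c. a holomorphic_on ball 0 r \<and> b holomorphic_on ball 0 r \<and> c holomorphic_on ball 0 r \<and>
      (\<forall>z. \<phi> p z $ 1 = z * a z) \<and> (\<forall>z. \<phi> p z $ 2 = z * b z) \<and> (\<forall>z. \<phi> p z $ 3 = z * (z * c z))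
      \<and> a 0 = 1/2 \<and> b 0 = 1/2" if p: "p \<in> {\<i>, -\<i>}" for p
  proof -
    have z: "\<phi> p 0 $ k = 0" for k by (simp add: \<phi>0)
    obtain a where a: "a holomorphic_on ball 0 r" "\<And>z. \<phi> p z $ 1 = z * a z" "a 0 = 1/2"
      using holomorphic_factor_simple_zero[OF \<phi>hol[OF p] open_ball z d\<phi>0, of 1] by auto
    obtain b where b: "b holomorphic_on ball 0 r" "\<And>z. \<phi> p z $ 2 = z * b z" "b 0 = 1/2"
      using holomorphic_factor_simple_zero[OF \<phi>hol[OF p] open_ball z d\<phi>0, of 2] by auto
    \<comment> \<open>The third coordinate also has derivative 0 at the origin, so it is divisible
      by \<open>z\<close> twice.\<close>
    obtain k where k: "k holomorphic_on ball 0 r" "\<And>z. \<phi> p z $ 3 = z * k z" "k 0 = 0"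
      using holomorphic_factor_simple_zero[OF \<phi>hol[OF p] open_ball z d\<phi>0, of 3] by auto
    have "(k has_field_derivative deriv k 0) (at 0)"
      using k(1) r by (intro holomorphic_derivI[of _ "ball 0 r"]) auto
    then obtain c where "c holomorphic_on ball 0 r" "\<And>z. k z = z * c z"
      using holomorphic_factor_simple_zero[OF k(1) open_ball k(3)] by metis
    with a b k show ?thesis by metis
  qed
  obtain a b c where abc: "a holomorphic_on ball 0 r" "b holomorphic_on ball 0 r" "c holomorphic_on ball 0 r"
      "\<And>z. \<phi> \<i> z $ 1 = z * a z" "\<And>z. \<phi> \<i> z $ 2 = z * b z" "\<And>z. \<phi> \<i> z $ 3 = z * (z * c z)"
      "a 0 = 1/2" "b 0 = 1/2"
    using ex[of \<i>] by blast
  obtain a' b' c' where abc': "a' holomorphic_on ball 0 r" "b' holomorphic_on ball 0 r" "c' holomorphic_on ball 0 r"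
      "\<And>z. \<phi> (-\<i>) z $ 1 = z * a' z" "\<And>z. \<phi> (-\<i>) z $ 2 = z * b' z" "\<And>z. \<phi> (-\<i>) z $ 3 = z * (z * c' z)"
      "a' 0 = 1/2" "b' 0 = 1/2"
    using ex[of "-\<i>"] by blast
  have e1: "cmod (w * (361/400 * c 0) - 19/40) \<le> cmod (1 - w * (19/40))" if "cmod w \<le> 1" for w
    using tetrablock_disc_centre_bound[of a r b c "19/20" "\<phi> \<i>" w] abc \<phi>T r that
    by (simp add: power2_eq_square)
  have e2: "cmod (w * (361/400 * c' 0) - 19/40) \<le> cmod (1 - w * (19/40))" if "cmod w \<le> 1" for w
    using tetrablock_disc_centre_bound[of a' r b' c' "19/20" "\<phi> (-\<i>)" w] abc' \<phi>T r that
    by (simp add: power2_eq_square)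
  have bound: "cmod (c 0 - c' 0 - \<i>) \<le> \<epsilon>" if \<epsilon>: "\<epsilon> > 0" for \<epsilon>
  proof -
    define N where "N = norm (vector [0, 0, 1] :: complex^3)"
    have "(vector [0, 0, 1] :: complex^3) \<noteq> 0" unfolding vec_eq_iff forall_3 by simp
    then have N: "N > 0" by (simp add: N_def)
    have lim: "(\<gamma> \<longlongrightarrow> 0) (at 0)" "(\<kappa> p \<longlongrightarrow> 0) (at 0)" for p
    proof -
      have "isCont \<gamma> 0" "isCont (\<kappa> p) 0"
        unfolding \<gamma>_def \<kappa>_def by (rule has_derivative_continuous[OF dcurve])+
      then show "(\<gamma> \<longlongrightarrow> 0) (at 0)" "(\<kappa> p \<longlongrightarrow> 0) (at 0)"
        by (simp_all only: isCont_def 0)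
    qed
    \<comment> \<open>Both axis curves are halved by the midpoint, which turns this difference into
      \<open>\<i> * z^2\<close> in the third coordinate.\<close>
    have \<kappa>: "\<kappa> \<i> z - \<kappa> (-\<i>) z = (2 * \<i> * z^2) *s vector [0, 0, 1]" for z
      by (simp add: \<kappa>_def vec_eq_iff)
    \<comment> \<open>The tolerance cancels the norm \<open>2 * N * cmod (z^2)\<close> of the
      difference of the axis curves, so that division by \<open>z^2\<close> leaves exactly
      \<open>\<epsilon>\<close>.\<close>
    have "\<forall>\<^sub>F z in at 0. norm (\<phi> \<i> z - \<phi> (-\<i>) z - (1/2) *\<^sub>R (\<kappa> \<i> z - \<kappa> (-\<i>) z))
        \<le> \<epsilon> / (2 * N) * norm (\<kappa> \<i> z - \<kappa> (-\<i>) z)"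
      unfolding \<phi>_def h_def
      by (rule midpoint_pullback_difference[OF f(1) D(1) D0 g(1) G(1) G0 inv lim(1) lim(2) lim(2)])
         (use \<epsilon> N in auto)
    moreover have "\<forall>\<^sub>F z in at 0. z \<noteq> (0::complex)" by (simp add: eventually_at_filter)
    ultimately have near: "\<forall>\<^sub>F z in at 0. cmod (c z - c' z - \<i>) \<le> \<epsilon>"
    proof eventually_elim
      case (elim z)
      have third: "(\<phi> \<i> z - \<phi> (-\<i>) z - (1/2) *\<^sub>R (\<kappa> \<i> z - \<kappa> (-\<i>) z)) $ 3 = z^2 * (c z - c' z - \<i>)"
        unfolding \<kappa> vector_minus_component vector_scaleR_component vector_smult_component vector_3
          abc(6) abc'(6)
        by (simp add: scaleR_conv_of_real algebra_simps power2_eq_square)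
      have "cmod (z^2 * (c z - c' z - \<i>)) \<le> \<epsilon> / (2 * N) * norm (\<kappa> \<i> z - \<kappa> (-\<i>) z)"
        using order_trans[OF Finite_Cartesian_Product.norm_nth_le[of _ 3] elim(1)] unfolding third .
      also have "\<dots> = cmod (z^2) * \<epsilon>"
        using N unfolding \<kappa> norm_vector_scalar_mult N_def[symmetric] by (simp add: norm_mult)
      finally show ?case using elim(2) by (simp add: norm_mult)
    qed
    have "isCont k 0" if "k holomorphic_on ball 0 r" for k
      using holomorphic_on_imp_continuous_on[OF that] r by (simp add: continuous_on_eq_continuous_at)
    from this[OF abc(3)] this[OF abc'(3)]
    have "((\<lambda>z. cmod (c z - c' z - \<i>)) \<longlongrightarrow> cmod (c 0 - c' 0 - \<i>)) (at 0)"
      unfolding isCont_def by (intro tendsto_intros)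
    from tendsto_upperbound[OF this near] show ?thesis by simp
  qed
  have "cmod (c 0 - c' 0 - \<i>) \<le> 0"
    by (rule field_le_epsilon) (simp only: add_0 bound)
  then have "c 0 - c' 0 = \<i>" by simp
  from this e1 e2 show False by (rule moebius_bounds_incompatible)
qed

section \<open>From the exhaustion to a single domain\<close>

theorem theorem2:
  shows "\<not> (\<exists>D :: nat \<Rightarrow> (complex^3) set.
            (\<forall>j. cdomain (D j)) \<and> (\<forall>j. D j \<subseteq> D (Suc j)) \<and>
            (\<Union>j. D j) = tetrablock \<and>
            (\<forall>j. \<exists>G. cdomain G \<and> convex G \<and> biholomorphic (D j) G))"
proof
  assume "\<exists>D :: nat \<Rightarrow> (complex^3) set.
            (\<forall>j. cdomain (D j)) \<and> (\<forall>j. D j \<subseteq> D (Suc j)) \<and>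
            (\<Union>j. D j) = tetrablock \<and>
            (\<forall>j. \<exists>G. cdomain G \<and> convex G \<and> biholomorphic (D j) G)"
  then obtain D :: "nat \<Rightarrow> (complex^3) set" where dom: "\<forall>j. cdomain (D j)"
    and "\<forall>j. D j \<subseteq> D (Suc j)" and "(\<Union>j. D j) = tetrablock"
    and G: "\<forall>j. \<exists>G. cdomain G \<and> convex G \<and> biholomorphic (D j) G"
    by (elim exE conjE)
  then have D: "\<And>j. open (D j)" "\<And>j. D j \<subseteq> D (Suc j)" "(\<Union>j. D j) = tetrablock"
    by (simp_all add: cdomain_def)
  define \<gamma> :: "complex \<Rightarrow> complex^3" where "\<gamma> z = vector [z, z, z^2]" for z
  define \<kappa> :: "complex \<Rightarrow> complex \<Rightarrow> complex^3" where "\<kappa> p z = vector [0, 0, p * z^2]" for p z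
  \<comment> \<open>The radius 39/40 lies strictly between 19/20, which the disc argument has to
    exceed, and 1, below which the closed discs are compact in the tetrablock.\<close>
  define C where "C = cball (0::complex) (39/40)"
  define K where "K = \<gamma> ` C \<union> (\<kappa> \<i> ` C \<union> \<kappa> (-\<i>) ` C)"
  have "continuous_on C \<gamma>" "continuous_on C (\<kappa> p)" for p
    unfolding \<gamma>_def \<kappa>_def diagonal_curve_conv axis_curve_conv
    by (intro continuous_at_imp_continuous_on ballI has_derivative_continuous[OF has_derivative_quadratic_curve])+
  then have "compact K" unfolding K_def C_def
    by (intro compact_Un compact_continuous_image compact_cball)
  moreover have "K \<subseteq> tetrablock"
  proof -
    have "\<gamma> z \<in> tetrablock" if "z \<in> C" for z
      using diagonal_in_tetrablock[of z] that by (simp add: C_def \<gamma>_def)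
    moreover have "\<kappa> p z \<in> tetrablock" if "z \<in> C" "cmod p = 1" for p z
      using that third_axis_in_tetrablock[of "p * z^2"]
      by (simp add: C_def \<kappa>_def norm_mult norm_power abs_square_less_1)
    ultimately show ?thesis unfolding K_def by auto
  qed
  ultimately obtain j where j: "K \<subseteq> D j"
    using incseq_open_cover_compact[of D K] D by metis
  obtain G where "open G" "convex G" "biholomorphic (D j) G"
    using G unfolding cdomain_def by metis
  moreover have "vector [z, z, z^2] \<in> D j" if "z \<in> ball 0 (39/40)" for z
    using j that by (auto simp: K_def C_def \<gamma>_def)
  moreover have "vector [0, 0, p * z^2] \<in> D j" if "p \<in> {\<i>, -\<i>}" "z \<in> ball 0 (39/40)" for p z
    using j that by (auto simp: K_def C_def \<kappa>_def)
  moreover have "D j \<subseteq> tetrablock" using D(3) by blast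
  ultimately show False
    by (intro tetrablock_subdomain_not_biholomorphic_convex[of "39/40" "D j" G] D(1)) simp_all
qed

end
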